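(* Let $(X,\mathcal{A},\mu)$ be a measure space, let $f$ be a measurable (real- or complex-valued) function on $X$, and let $l,s,m\in[1,\infty]$ with $l<s<m$. If $m<\infty$, then $$\left(\|f\|_s\right)^s\le \left(\|f\|_l\right)^{\,l\frac{m-s}{m-l}}\left(\|f\|_m\right)^{\,m\frac{s-l}{m-l}}.$$ If $m=\infty$, then $$\left(\|f\|_s\right)^s\le \left(\|f\|_l\right)^{l}\left(\|f\|_\infty\right)^{s-l}.$$
   Context: For $1\le p<\infty$, $\|f\|_p=\left(\int_X|f|^p\,d\mu\right)^{1/p}\in[0,\infty]$, and $\|f\|_\infty$ is the essential supremum of $|f|$. Note that $l<s<m$ forces $l$ and $s$ to be finite. *)

theory Defs
  imports "HOL-Probability.Essential_Supremum"
begin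

text \<open>Powers of extended nonnegative reals. Only exponents \<open>r > 0\<close> are meaningful here: then
  \<open>0\<close> and \<open>\<infinity>\<close> are fixed (note that \<open>0 powr r = 0\<close>), and finite values get the usual real power.\<close>

definition ennreal_powr :: "ennreal \<Rightarrow> real \<Rightarrow> ennreal" where
  "ennreal_powr x r = (if x = \<infinity> then \<infinity> else ennreal (enn2real x powr r))"

text \<open>The \<open>L\<^sup>p\<close> norm with values in \<open>[0, \<infinity>]\<close>, for \<open>p \<in> [1, \<infinity>]\<close> and \<open>f\<close> measurable.
  The type class \<open>real_normed_field\<close> covers exactly the real- and complex-valued functions:
  \<open>real\<close> and \<open>complex\<close> are instances, and by the Gelfand--Mazur theorem every instance is
  isometrically isomorphic to one of them.\<close>

definition Lp_norm :: "'a measure \<Rightarrow> ennreal \<Rightarrow> ('a \<Rightarrow> 'b::real_normed_field) \<Rightarrow> ennreal" where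
  "Lp_norm M p f =
    (if p = \<infinity> then esssup M (\<lambda>x. ennreal (norm (f x)))
     else ennreal_powr (\<integral>\<^sup>+x. ennreal (norm (f x) powr enn2real p) \<partial>M) (1 / enn2real p))"

end

theory Submission
  imports Defs
begin

text \<open>
  Write \<open>\<theta> = (m - s) / (m - l)\<close> and \<open>\<tau> = (s - l) / (m - l)\<close>, so that \<open>\<theta> + \<tau> = 1\<close> and
  \<open>s = l \<theta> + m \<tau>\<close>. The claim for finite \<open>m\<close> is Hoelder's inequality with the exponents
  \<open>1 / \<theta>\<close> and \<open>1 / \<tau>\<close>, applied to the factorisation \<open>|f|\<^sup>s = (|f|\<^sup>l)\<^sup>\<theta> (|f|\<^sup>m)\<^sup>\<tau>\<close>. Hoelder's
  inequality comes in the form \<open>\<integral> g\<^sup>\<theta> h\<^sup>\<tau> \<le> (\<integral> g)\<^sup>\<theta> (\<integral> h)\<^sup>\<tau>\<close>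
  (\<open>nn_integral_powr_mult_le\<close>); it follows from the pointwise weighted inequality between
  arithmetic and geometric means after \<open>g\<close> and \<open>h\<close> have been scaled to integral \<open>1\<close>.

  For \<open>m = \<infinity>\<close>, almost everywhere \<open>|f|\<^sup>s = |f|\<^sup>l |f|\<^bsup>s - l\<^esup> \<le> |f|\<^sup>l \<parallel>f\<parallel>\<^sub>\<infinity>\<^bsup>s - l\<^esup>\<close>, and the
  last factor is a constant that can be taken out of the integral.

  Infinite norms need some care because a product \<open>0 \<cdot> \<infinity>\<close> is \<open>0\<close>: such a product on the
  right-hand side is harmless because a vanishing factor forces \<open>f = 0\<close> almost everywhere.
\<close>

lemma ennreal_powr_ennreal: "0 \<le> x \<Longrightarrow> ennreal_powr (ennreal x) r = ennreal (x powr r)"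
  by (simp add: ennreal_powr_def)

lemma ennreal_powr_top [simp]: "ennreal_powr top r = top"
  by (simp add: ennreal_powr_def)

lemma ennreal_powr_one [simp]: "ennreal_powr x 1 = x"
  by (cases x) (auto simp: ennreal_powr_def)

lemma ennreal_powr_eq_0_iff: "ennreal_powr x r = 0 \<longleftrightarrow> x = 0"
  by (cases x) (auto simp: ennreal_powr_def ennreal_eq_0_iff)

lemma ennreal_powr_powr: "ennreal_powr (ennreal_powr x r) q = ennreal_powr x (r * q)"
  by (auto simp: ennreal_powr_def powr_powr)

lemma ennreal_powr_Lp_norm:
  assumes "0 < p" and "p < \<infinity>"
  shows "ennreal_powr (Lp_norm M p f) (enn2real p * t) =
    ennreal_powr (\<integral>\<^sup>+x. ennreal (norm (f x) powr enn2real p) \<partial>M) t"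
proof -
  have "enn2real p > 0"
    using assms by (simp add: enn2real_positive_iff)
  then show ?thesis
    using assms by (auto simp: Lp_norm_def ennreal_powr_powr)
qed

text \<open>
  This is Hoelder's inequality for the functions \<open>g\<^sup>\<theta>\<close> and \<open>h\<^sup>\<tau>\<close> with the conjugate
  exponents \<open>1 / \<theta>\<close> and \<open>1 / \<tau>\<close>.
\<close>

lemma nn_integral_powr_mult_le:
  fixes g h :: "'a \<Rightarrow> real" and \<theta> \<tau> :: real
  assumes [measurable]: "g \<in> borel_measurable M" "h \<in> borel_measurable M"
    and g: "\<And>x. 0 \<le> g x" and h: "\<And>x. 0 \<le> h x"
    and \<theta>: "0 < \<theta>" and \<tau>: "0 < \<tau>" and sum: "\<theta> + \<tau> = 1"
  shows "(\<integral>\<^sup>+x. ennreal (g x powr \<theta> * h x powr \<tau>) \<partial>M)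
    \<le> ennreal_powr (\<integral>\<^sup>+x. ennreal (g x) \<partial>M) \<theta> * ennreal_powr (\<integral>\<^sup>+x. ennreal (h x) \<partial>M) \<tau>"
    (is "?L \<le> ennreal_powr ?G \<theta> * ennreal_powr ?H \<tau>")
proof -
  consider "?G = 0 \<or> ?H = 0" | "?G \<noteq> 0" "?H \<noteq> 0" "?G = \<infinity> \<or> ?H = \<infinity>"
    | "?G \<noteq> 0" "?H \<noteq> 0" "?G \<noteq> \<infinity>" "?H \<noteq> \<infinity>"
    by blast
  then show ?thesis
  proof cases
    case 1
    then have "(AE x in M. g x = 0) \<or> (AE x in M. h x = 0)"
      using g h by (simp add: nn_integral_0_iff_AE ennreal_eq_0_iff antisym_conv)
    then have "AE x in M. g x powr \<theta> * h x powr \<tau> = 0"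
      by auto
    then have "?L = 0"
      by (subst nn_integral_0_iff_AE) auto
    then show ?thesis
      by simp
  next
    case 2
    then have "ennreal_powr ?G \<theta> * ennreal_powr ?H \<tau> = \<infinity>"
      by (auto simp: ennreal_powr_eq_0_iff ennreal_top_mult ennreal_mult_top)
    then show ?thesis
      by simp
  next
    case 3
    obtain A where A: "?G = ennreal A" "0 < A"
      using 3 by (cases ?G) (auto simp: less_le)
    obtain B where B: "?H = ennreal B" "0 < B"
      using 3 by (cases ?H) (auto simp: less_le)
    define C where "C = A powr \<theta> * B powr \<tau>"
    have C: "0 \<le> C"
      by (simp add: C_def)
    have pointwise: "g x powr \<theta> * h x powr \<tau> \<le> C * (\<theta> / A * g x + \<tau> / B * h x)" for x
    proof -
      have "(g x / A) powr \<theta> * (h x / B) powr \<tau> \<le> \<theta> * (g x / A) + \<tau> * (h x / B)"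
      proof (cases "g x = 0 \<or> h x = 0")
        case True
        then show ?thesis
          using g h A B \<theta> \<tau> by auto
      next
        case False
        then have "0 < g x / A" "0 < h x / B"
          using g[of x] h[of x] A B by (simp_all add: less_le)
        then show ?thesis
          using \<theta> \<tau> sum by (intro Youngs_inequality_0) auto
      qed
      then have "C * ((g x / A) powr \<theta> * (h x / B) powr \<tau>) \<le> C * (\<theta> * (g x / A) + \<tau> * (h x / B))"
        using C by (rule mult_left_mono)
      moreover have "C * ((g x / A) powr \<theta> * (h x / B) powr \<tau>) = g x powr \<theta> * h x powr \<tau>"
        using A B g h by (simp add: C_def powr_divide)
      ultimately show ?thesis
        by simp
    qed
    have "?L \<le> (\<integral>\<^sup>+x. ennreal C * (ennreal (\<theta> / A) * ennreal (g x)
        + ennreal (\<tau> / B) * ennreal (h x)) \<partial>M)"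
      using pointwise A B C g h \<theta> \<tau>
      by (intro nn_integral_mono) (simp flip: ennreal_mult ennreal_plus)
    also have "\<dots> = ennreal C * (ennreal (\<theta> / A) * ?G + ennreal (\<tau> / B) * ?H)"
      by (simp add: nn_integral_cmult nn_integral_add)
    also have "\<dots> = ennreal C * ennreal (\<theta> + \<tau>)"
      using A B \<theta> \<tau> by (simp flip: ennreal_mult ennreal_plus)
    also have "\<dots> = ennreal_powr ?G \<theta> * ennreal_powr ?H \<tau>"
      using A B sum by (simp add: C_def ennreal_powr_ennreal ennreal_mult)
    finally show ?thesis .
  qed
qed

lemma nn_integral_powr_interpolate:
  fixes f :: "'a \<Rightarrow> real" and l s m :: real
  assumes [measurable]: "f \<in> borel_measurable M" and "l < s" and "s < m"
  shows "(\<integral>\<^sup>+x. ennreal (f x powr s) \<partial>M)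
    \<le> ennreal_powr (\<integral>\<^sup>+x. ennreal (f x powr l) \<partial>M) ((m - s) / (m - l))
      * ennreal_powr (\<integral>\<^sup>+x. ennreal (f x powr m) \<partial>M) ((s - l) / (m - l))"
proof -
  let ?\<theta> = "(m - s) / (m - l)" and ?\<tau> = "(s - l) / (m - l)"
  have weights: "0 < ?\<theta>" "0 < ?\<tau>" "?\<theta> + ?\<tau> = 1"
    using assms(2,3) by (simp_all flip: add_divide_distrib)
  have s: "l * ?\<theta> + m * ?\<tau> = s"
    using assms(2,3) by (simp add: divide_simps) (simp add: algebra_simps)
  have "f x powr s = (f x powr l) powr ?\<theta> * (f x powr m) powr ?\<tau>" for x
    using s by (simp only: powr_powr flip: powr_add)
  then show ?thesis
    using nn_integral_powr_mult_le[of "\<lambda>x. f x powr l" M "\<lambda>x. f x powr m", OF _ _ _ _ weights]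
    by simp
qed

text \<open>
  The integrands already satisfy the inequality wherever \<open>f\<close> is bounded by its essential
  supremum \<open>S\<close>, hence almost everywhere. For \<open>S = \<infinity>\<close> it remains true where \<open>f\<close> vanishes
  because there both sides are \<open>0\<close>.
\<close>

lemma nn_integral_powr_le_esssup:
  fixes f :: "'a \<Rightarrow> real" and l s :: real
  assumes [measurable]: "f \<in> borel_measurable M" and f: "\<And>x. 0 \<le> f x"
    and "l < s"
  shows "(\<integral>\<^sup>+x. ennreal (f x powr s) \<partial>M)
    \<le> (\<integral>\<^sup>+x. ennreal (f x powr l) \<partial>M) * ennreal_powr (esssup M (\<lambda>x. ennreal (f x))) (s - l)"
    (is "_ \<le> _ * ennreal_powr ?S _")
proof -
  have pointwise: "ennreal (f x powr s) \<le> ennreal (f x powr l) * ennreal_powr ?S (s - l)"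
    if le: "ennreal (f x) \<le> ?S" for x
  proof (cases ?S)
    case (real r)
    then have "f x powr (s - l) \<le> r powr (s - l)"
      using le f \<open>l < s\<close> by (intro powr_mono2) auto
    then have "f x powr l * f x powr (s - l) \<le> f x powr l * r powr (s - l)"
      by (rule mult_left_mono) simp
    then show ?thesis
      using real by (simp add: ennreal_powr_ennreal ennreal_leI flip: powr_add ennreal_mult)
  next
    case top
    then show ?thesis
      by (cases "f x = 0") (auto simp: ennreal_mult_top)
  qed
  have "(\<integral>\<^sup>+x. ennreal (f x powr s) \<partial>M)
    \<le> (\<integral>\<^sup>+x. ennreal (f x powr l) * ennreal_powr ?S (s - l) \<partial>M)"
    using esssup_AE[of "\<lambda>x. ennreal (f x)" M]
    by (intro nn_integral_mono_AE) (auto elim!: eventually_mono intro: pointwise)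
  also have "\<dots> = (\<integral>\<^sup>+x. ennreal (f x powr l) \<partial>M) * ennreal_powr ?S (s - l)"
    by (rule nn_integral_multc) simp
  finally show ?thesis .
qed

theorem theorem2p1:
  fixes M :: "'a measure"
    and f :: "'a \<Rightarrow> 'b::real_normed_field"
    and l s m :: ennreal
  assumes "f \<in> borel_measurable M"
    and "1 \<le> l" and "l < s" and "s < m"
  shows "(m < \<infinity> \<longrightarrow>
            ennreal_powr (Lp_norm M s f) (enn2real s)
            \<le> ennreal_powr (Lp_norm M l f)
                 (enn2real l * ((enn2real m - enn2real s) / (enn2real m - enn2real l)))
              * ennreal_powr (Lp_norm M m f)
                 (enn2real m * ((enn2real s - enn2real l) / (enn2real m - enn2real l))))
       \<and> (m = \<infinity> \<longrightarrow>
            ennreal_powr (Lp_norm M s f) (enn2real s)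
            \<le> ennreal_powr (Lp_norm M l f) (enn2real l)
              * ennreal_powr (Lp_norm M \<infinity> f) (enn2real s - enn2real l))"
proof -
  have f [measurable]: "(\<lambda>x. norm (f x)) \<in> borel_measurable M"
    using assms(1) borel_measurable_norm by (rule measurable_compose)
  have fin: "l < \<infinity>" "s < \<infinity>"
    using assms(3,4) by (auto intro: less_trans less_le_trans)
  have pos: "0 < l" "0 < s" "0 < m"
    using assms(2-4) by (auto intro: less_le_trans[OF zero_less_one] less_trans order.strict_trans2)
  have ls: "enn2real l < enn2real s"
    using assms(3) fin by (simp add: enn2real_less_iff)
  have norm_s: "ennreal_powr (Lp_norm M s f) (enn2real s)
      = (\<integral>\<^sup>+x. ennreal (norm (f x) powr enn2real s) \<partial>M)"
    using ennreal_powr_Lp_norm[of s M f 1] pos fin by simp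
  show ?thesis
  proof (intro conjI impI)
    assume m: "m < \<infinity>"
    have sm: "enn2real s < enn2real m"
      using assms(4) fin m by (simp add: enn2real_less_iff)
    show "ennreal_powr (Lp_norm M s f) (enn2real s)
      \<le> ennreal_powr (Lp_norm M l f)
          (enn2real l * ((enn2real m - enn2real s) / (enn2real m - enn2real l)))
        * ennreal_powr (Lp_norm M m f)
          (enn2real m * ((enn2real s - enn2real l) / (enn2real m - enn2real l)))"
      unfolding norm_s ennreal_powr_Lp_norm[OF pos(1) fin(1)] ennreal_powr_Lp_norm[OF pos(3) m]
      using nn_integral_powr_interpolate[OF f ls sm] by simp
  next
    have norm_l: "ennreal_powr (Lp_norm M l f) (enn2real l)
        = (\<integral>\<^sup>+x. ennreal (norm (f x) powr enn2real l) \<partial>M)"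
      using ennreal_powr_Lp_norm[of l M f 1] pos fin by simp
    show "ennreal_powr (Lp_norm M s f) (enn2real s)
      \<le> ennreal_powr (Lp_norm M l f) (enn2real l)
        * ennreal_powr (Lp_norm M \<infinity> f) (enn2real s - enn2real l)"
      unfolding norm_s norm_l
      using nn_integral_powr_le_esssup[OF f _ ls] by (simp add: Lp_norm_def)
  qed
qed

end
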